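(* Let $N\ge 2$ and consider a network of $N$ agents communicating over a connected undirected weighted graph with Laplacian $\mathbf{L}$, whose eigenvalues are $0=\lambda_1<\lambda_2\le\cdots\le\lambda_N$. Let $\mathsf{r}^1,\dots,\mathsf{r}^N\in\mathbb{R}$ and $\mathbf{r}=[\mathsf{r}^1,\dots,\mathsf{r}^N]^\top$. Let the agents implement the Triple-Momentum-based algorithm: for $k\ge 1$, $$\boldsymbol{\xi}(k+1)=(1+\beta)\boldsymbol{\xi}(k)-\beta\boldsymbol{\xi}(k-1)-\alpha\mathbf{L}\mathbf{y}(k),$$ $$\mathbf{y}(k)=(1+\gamma)\boldsymbol{\xi}(k)-\gamma\boldsymbol{\xi}(k-1),$$ $$\mathbf{x}(k)=(1+\delta)\boldsymbol{\xi}(k)-\delta\boldsymbol{\xi}(k-1),$$ with $\boldsymbol{\xi}(0)=\boldsymbol{\xi}(1)=\mathbf{r}$ and $$(\alpha,\beta,\gamma,\delta)=\left(\frac{1+\rho}{\lambda_N},\ \frac{\rho^2}{2-\rho},\ \frac{\rho^2}{(1+\rho)(2-\rho)},\ \frac{\rho^2}{1-\rho^2}\right),\qquad \rho=1-\sqrt{\frac{\lambda_2}{\lambda_N}}.$$ Then, for every $i\in\{1,\dots,N\}$, $x^i(k)\to\frac{1}{N}\sum_{j=1}^N\mathsf{r}^j$ as $k\to\infty$.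
   Context: The vectors $\boldsymbol{\xi}(k),\mathbf{y}(k),\mathbf{x}(k)$ are in $\mathbb{R}^N$, and $x^i(k)$ denotes the $i$-th component of $\mathbf{x}(k)$ (the agreement state of agent $i$). The graph has node set $\{1,\dots,N\}$ and symmetric adjacency matrix $\mathbf{A}=[a_{ij}]$ with $a_{ii}=0$, $a_{ij}=a_{ji}>0$ if $(i,j)$ is an edge and $a_{ij}=0$ otherwise. The Laplacian is $\mathbf{L}=\mathrm{Diag}(\mathbf{A}\mathbf{1}_N)-\mathbf{A}$; for a connected undirected graph it is symmetric positive semidefinite with simple eigenvalue $0$ and $\mathbf{L}\mathbf{1}_N=\mathbf{0}$. *)

theory Defs
  imports
    Complex_Main
    "Graph_Theory.Digraph_Component"
    "Jordan_Normal_Form.Char_Poly"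
begin

text \<open>
  Nodes are numbered \<open>0, \<dots>, N - 1\<close>, as are the entries of vectors and matrices. The condition
  \<open>A $$ (i, i) = 0\<close> is not listed in \<open>weighted_adjacency\<close>: \<^term>\<open>pair_graph\<close> excludes loops.
\<close>

definition weighted_adjacency :: "nat \<Rightarrow> nat pair_pre_digraph \<Rightarrow> real mat \<Rightarrow> bool" where
  "weighted_adjacency N G A \<longleftrightarrow>
     A \<in> carrier_mat N N \<and>
     (\<forall>i<N. \<forall>j<N. A $$ (i, j) = A $$ (j, i)) \<and>
     (\<forall>i<N. \<forall>j<N. (i, j) \<in> parcs G \<longrightarrow> A $$ (i, j) > 0) \<and>
     (\<forall>i<N. \<forall>j<N. (i, j) \<notin> parcs G \<longrightarrow> A $$ (i, j) = 0)"

definition ones_vec :: "nat \<Rightarrow> real vec" where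
  "ones_vec N = vec N (\<lambda>_. 1)"

definition Diag :: "real vec \<Rightarrow> real mat" where
  "Diag v = mat (dim_vec v) (dim_vec v) (\<lambda>(i, j). if i = j then v $ i else 0)"

definition laplacian :: "real mat \<Rightarrow> real mat" where
  "laplacian A = Diag (A *\<^sub>v ones_vec (dim_col A)) - A"

text \<open>
  The eigenvalues of a matrix listed with algebraic multiplicity, in nondecreasing order, as
  \<open>lam 1 \<le> \<dots> \<le> lam N\<close>. The values of \<open>lam\<close> outside \<open>{1..N}\<close> are irrelevant.
\<close>

definition ordered_eigenvalues :: "nat \<Rightarrow> real mat \<Rightarrow> (nat \<Rightarrow> real) \<Rightarrow> bool" where
  "ordered_eigenvalues N M lam \<longleftrightarrow>
     mono_on {1..N} lam \<and> char_poly M = (\<Prod>i=1..N. [:- lam i, 1:])"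

end

theory Submission
  imports Defs "Jordan_Normal_Form.Schur_Decomposition"
begin

text \<open>
  Because the characteristic polynomial of \<open>L\<close> splits, \<open>L\<close> is similar to an upper triangular
  matrix (\<open>schur_basis\<close>): there is a basis \<open>p\<^sub>1, \<dots>, p\<^sub>N\<close> such that \<open>L p\<^sub>j\<close> is \<open>lam j \<cdot> p\<^sub>j\<close> plus a combination of
  the earlier basis vectors. By the symmetry of \<open>L\<close>, the number \<open>p\<^sub>j \<bullet> \<xi> k\<close> obeys the scalar recursion of a single
  mode with eigenvalue \<open>lam j\<close>, forced by the earlier ones. This takes the place of
  an orthonormal eigenbasis, in which the forcing would vanish.

  The first mode has eigenvalue \<open>0\<close> and stays constant, because \<open>\<xi> 0 = \<xi> 1\<close>. Every other eigenvalue lies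
  in \<open>(0, lam N]\<close>, since connectedness makes the eigenvalue \<open>0\<close> simple
  (\<open>laplacian_second_eigenvalue_pos\<close>). For such an eigenvalue the algorithm's parameters put both
  characteristic roots of the mode inside the unit disc (\<open>triple_momentum_mode_stable\<close>), and a
  stable recursion with convergent forcing converges (\<open>second_order_recursion_convergent\<close>). By
  induction over the modes the iterates \<open>\<xi> k\<close> converge (\<open>momentum_iterates_convergent\<close>).

  Passing to the limit \<open>v\<close> in the recursion gives \<open>L v = 0\<close>, so \<open>v\<close> is a constant vector. The sum
  of the entries of \<open>\<xi> k\<close> is conserved because the columns of \<open>L\<close> sum to zero, which identifies the
  constant as the mean of \<open>r\<close> (\<open>laplacian_momentum_limit\<close>). Finally \<open>x k\<close> is a combination of
  \<open>\<xi> k\<close> and \<open>\<xi> (k - 1)\<close> with coefficients summing to \<open>1\<close>, so it has the same limit.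
\<close>

section \<open>Stable scalar recursions\<close>

text \<open>
  Once the forcing is below \<open>e / 2 \<cdot> (1 - \<bar>s\<bar>)\<close>, its geometrically weighted accumulation never exceeds
  \<open>e / 2\<close>, while the contribution of the past decays like \<open>\<bar>s\<bar> ^ n\<close>.
\<close>

lemma first_order_recursion_tendsto_0:
  fixes u f :: "nat \<Rightarrow> complex"
  assumes s: "norm s < 1" and f: "f \<longlonglongrightarrow> 0" and u: "\<And>k. u (Suc k) = s * u k + f k"
  shows "u \<longlonglongrightarrow> 0"
proof (rule LIMSEQ_I)
  fix e :: real assume e: "e > 0"
  define d where "d = e / 2 * (1 - norm s)"
  have "d > 0" using e s by (simp add: d_def)
  then obtain K where K: "\<And>k. k \<ge> K \<Longrightarrow> norm (f k) < d"
    using LIMSEQ_D[OF f] by fastforce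
  have bound: "norm (u (K + n)) \<le> norm s ^ n * norm (u K) + e / 2" for n
  proof (induction n)
    case 0
    show ?case using e by simp
  next
    case (Suc n)
    have "norm (u (K + Suc n)) \<le> norm s * norm (u (K + n)) + norm (f (K + n))"
      using u[of "K + n"] norm_triangle_ineq[of "s * u (K + n)" "f (K + n)"] by (simp add: norm_mult)
    also have "\<dots> \<le> norm s * (norm s ^ n * norm (u K) + e / 2) + d"
      using mult_left_mono[OF Suc norm_ge_zero[of s]] K[of "K + n"] by simp
    also have "\<dots> = norm s ^ Suc n * norm (u K) + e / 2"
      by (simp add: d_def field_simps)
    finally show ?case .
  qed
  have "(\<lambda>n. norm s ^ n * norm (u K)) \<longlonglongrightarrow> 0"
    using s by (intro tendsto_mult_left_zero LIMSEQ_power_zero) simp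
  then obtain m where m: "\<And>n. n \<ge> m \<Longrightarrow> norm s ^ n * norm (u K) < e / 2"
    using LIMSEQ_D[of _ 0 "e / 2"] e by fastforce
  have "norm (u k - 0) < e" if "k \<ge> K + m" for k
  proof -
    have "norm s ^ (k - K) * norm (u K) < e / 2" using that by (intro m) simp
    then show ?thesis using bound[of "k - K"] that by simp
  qed
  then show "\<exists>k0. \<forall>k\<ge>k0. norm (u k - 0) < e" by blast
qed

text \<open>
  The Jury criterion for \<open>X\<^sup>2 - a X + b\<close>. Non-real roots are conjugate, so \<open>b\<close> is their squared
  modulus. For real roots the hypothesis on \<open>a\<close> says that the polynomial is positive at \<open>1\<close> and
  \<open>-1\<close>; hence either both roots lie in \<open>(-1, 1)\<close>, or both lie beyond the same end and have a
  product larger than \<open>1\<close>.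
\<close>

lemma quadratic_roots_in_unit_disc:
  fixes a b :: real
  assumes b: "\<bar>b\<bar> < 1" and a: "\<bar>a\<bar> < 1 + b"
  obtains s t :: complex where "s + t = of_real a" "s * t = of_real b" "norm s < 1" "norm t < 1"
proof -
  define d where "d = csqrt (of_real (a\<^sup>2 - 4 * b))"
  define s where "s = (of_real a + d) / 2"
  define t where "t = (of_real a - d) / 2"
  have sum: "s + t = of_real a" by (simp add: s_def t_def field_simps)
  have "d\<^sup>2 = of_real (a\<^sup>2 - 4 * b)" by (simp add: d_def)
  then have prod: "s * t = of_real b"
    by (simp add: s_def t_def field_simps power2_eq_square)
  have re: "Re s + Re t = a" and im: "Im t = - Im s"
    using arg_cong[OF sum, of Re] arg_cong[OF sum, of Im] by auto
  have rep: "Re s * Re t + (Im s)\<^sup>2 = b" and imp: "Im s * (Re t - Re s) = 0"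
    using arg_cong[OF prod, of Re] arg_cong[OF prod, of Im] im
    by (auto simp: power2_eq_square algebra_simps)
  have "norm s < 1 \<and> norm t < 1"
  proof (cases "Im s = 0")
    case True
    have p: "(1 - Re s) * (1 - Re t) > 0" "(1 + Re s) * (1 + Re t) > 0"
      using re rep True a by (auto simp: algebra_simps)
    have q: "\<bar>Re s * Re t\<bar> < 1" using rep True b by simp
    have "\<not> (1 < Re s \<and> 1 < Re t)"
      using q mult_strict_mono[of 1 "Re s" 1 "Re t"] by auto
    moreover have "\<not> (Re s < -1 \<and> Re t < -1)"
      using q mult_strict_mono[of 1 "- Re s" 1 "- Re t"] by auto
    ultimately have "\<bar>Re s\<bar> < 1 \<and> \<bar>Re t\<bar> < 1"
      using p by (auto simp: zero_less_mult_iff)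
    then show ?thesis using True im by (simp add: cmod_def)
  next
    case False
    then have "Re t = Re s" using imp by simp
    then have "(norm s)\<^sup>2 = b" "(norm t)\<^sup>2 = b"
      using rep im by (simp_all only: cmod_power2, simp_all add: power2_eq_square)
    then show ?thesis
      using b by (metis abs_less_iff abs_norm_cancel abs_square_less_1)
  qed
  then show ?thesis using that sum prod by blast
qed

text \<open>
  With \<open>s\<close> and \<open>t\<close> the characteristic roots, \<open>u (k + 1) - s u k\<close> satisfies a first-order
  recursion with ratio \<open>t\<close>, and itself forces a first-order recursion for \<open>u\<close> with ratio \<open>s\<close>.
\<close>

lemma second_order_recursion_convergent:
  fixes u f :: "nat \<Rightarrow> real"
  assumes b: "\<bar>b\<bar> < 1" and a: "\<bar>a\<bar> < 1 + b" and f: "convergent f"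
    and u: "\<And>k. u (Suc (Suc k)) = a * u (Suc k) - b * u k + f k"
  shows "convergent u"
proof -
  obtain F where F: "f \<longlonglongrightarrow> F" using f by (auto simp: convergent_def)
  obtain s t :: complex
    where st: "s + t = of_real a" "s * t = of_real b" "norm s < 1" "norm t < 1"
    using quadratic_roots_in_unit_disc[OF b a] .
  \<comment> \<open>The equilibrium under the constant forcing \<open>F\<close>; subtracting it makes the forcing vanish in the limit.\<close>
  define U where "U = F / (1 - a + b)"
  have U: "U = a * U - b * U + F"
  proof -
    have "U * (1 - a + b) = F" using a by (simp add: U_def)
    then show ?thesis by (simp add: algebra_simps)
  qed
  define v :: "nat \<Rightarrow> complex" where "v k = of_real (u k - U)" for k
  define w where "w k = v (Suc k) - s * v k" for k
  have "(\<lambda>k. complex_of_real (f k - F)) \<longlonglongrightarrow> of_real (F - F)"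
    by (intro tendsto_intros F)
  moreover have "w (Suc k) = t * w k + of_real (f k - F)" for k
  proof -
    have "u (Suc (Suc k)) - U = a * (u (Suc k) - U) - b * (u k - U) + (f k - F)"
      using u[of k] U by (simp add: algebra_simps)
    then have "v (Suc (Suc k)) = (s + t) * v (Suc k) - s * t * v k + of_real (f k - F)"
      unfolding v_def st(1,2) by (simp only: of_real_add of_real_diff of_real_mult)
    then show ?thesis by (simp add: w_def algebra_simps)
  qed
  ultimately have "w \<longlonglongrightarrow> 0"
    using first_order_recursion_tendsto_0[OF st(4)] by simp
  moreover have "v (Suc k) = s * v k + w k" for k by (simp add: w_def)
  ultimately have "v \<longlonglongrightarrow> 0"
    using first_order_recursion_tendsto_0[OF st(3)] by blast
  then have "(\<lambda>k. Re (v k)) \<longlonglongrightarrow> Re 0" by (rule tendsto_Re)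
  then have "(\<lambda>k. u k - U) \<longlonglongrightarrow> 0" by (simp add: v_def)
  then show ?thesis by (auto simp: convergent_def LIM_zero_iff)
qed

section \<open>Parameters of the triple momentum method\<close>

text \<open>
  With \<open>c = \<alpha> \<mu> \<in> (0, 1 + \<rho>]\<close> and \<open>(1 + \<rho>) \<gamma> = \<beta> < 1\<close>, the constant coefficient
  \<open>b = \<beta> - c \<gamma>\<close> lies in \<open>[0, 1)\<close>. The characteristic polynomial takes the value \<open>c > 0\<close> at \<open>1\<close>,
  and at \<open>-1\<close> the value \<open>2 + 2 \<beta> - c (1 + 2 \<gamma>) \<ge> 1 - \<rho> > 0\<close>.
\<close>

lemma triple_momentum_mode_stable:
  fixes \<mu> M \<rho> :: real
  assumes \<mu>: "0 < \<mu>" "\<mu> \<le> M" and \<rho>: "0 \<le> \<rho>" "\<rho> < 1"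
    and \<alpha>: "\<alpha> = (1 + \<rho>) / M" and \<beta>: "\<beta> = \<rho>\<^sup>2 / (2 - \<rho>)"
    and \<gamma>: "\<gamma> = \<rho>\<^sup>2 / ((1 + \<rho>) * (2 - \<rho>))"
  shows "\<bar>\<beta> - \<alpha> * \<mu> * \<gamma>\<bar> < 1"
    and "\<bar>1 + \<beta> - \<alpha> * \<mu> * (1 + \<gamma>)\<bar> < 1 + (\<beta> - \<alpha> * \<mu> * \<gamma>)"
proof -
  define c where "c = \<alpha> * \<mu>"
  have c: "0 < c" "c \<le> 1 + \<rho>"
    using \<mu> \<rho> mult_left_mono[of \<mu> M "1 + \<rho>"]
    by (auto simp: c_def \<alpha> pos_divide_le_eq)
  have \<gamma>0: "\<gamma> \<ge> 0" using \<rho> by (simp add: \<gamma>)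
  have \<beta>\<gamma>: "(1 + \<rho>) * \<gamma> = \<beta>" using \<rho> by (simp add: \<gamma> \<beta>)
  have "\<rho>\<^sup>2 < 2 - \<rho>"
    using \<rho> mult_left_mono[of \<rho> 1 \<rho>] by (simp add: power2_eq_square)
  then have \<beta>1: "\<beta> < 1" using \<rho> by (simp add: \<beta> field_simps)
  have c\<gamma>: "c * \<gamma> \<le> \<beta>" "0 \<le> c * \<gamma>"
    using mult_right_mono[OF c(2) \<gamma>0] \<beta>\<gamma> c \<gamma>0 by auto
  show "\<bar>\<beta> - \<alpha> * \<mu> * \<gamma>\<bar> < 1"
    using c\<gamma> \<beta>1 by (simp add: c_def[symmetric])
  show "\<bar>1 + \<beta> - \<alpha> * \<mu> * (1 + \<gamma>)\<bar> < 1 + (\<beta> - \<alpha> * \<mu> * \<gamma>)"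
    unfolding c_def[symmetric] using c c\<gamma> \<rho> by (simp add: algebra_simps abs_less_iff)
qed

section \<open>Weighted graph Laplacians\<close>

lemma laplacian_carrier: "A \<in> carrier_mat N N \<Longrightarrow> laplacian A \<in> carrier_mat N N"
  by (auto simp: laplacian_def Diag_def)

lemma laplacian_index:
  assumes "A \<in> carrier_mat N N" "i < N" "j < N"
  shows "laplacian A $$ (i, j) = (if i = j then \<Sum>k<N. A $$ (i, k) else 0) - A $$ (i, j)"
  using assms by (auto simp: laplacian_def Diag_def ones_vec_def scalar_prod_def atLeast0LessThan)

lemma laplacian_mult_vec_index:
  assumes A: "A \<in> carrier_mat N N" and v: "v \<in> carrier_vec N" and i: "i < N"
  shows "(laplacian A *\<^sub>v v) $ i = (\<Sum>j<N. A $$ (i, j) * (v $ i - v $ j))"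
proof -
  have "(laplacian A *\<^sub>v v) $ i = (\<Sum>j<N. laplacian A $$ (i, j) * v $ j)"
    using laplacian_carrier[OF A] v i by (auto simp: scalar_prod_def atLeast0LessThan)
  also have "\<dots> = (\<Sum>j<N. (if i = j then (\<Sum>k<N. A $$ (i, k)) * v $ j else 0) - A $$ (i, j) * v $ j)"
    using A i by (intro sum.cong) (auto simp: laplacian_index algebra_simps)
  also have "\<dots> = (\<Sum>j<N. A $$ (i, j)) * v $ i - (\<Sum>j<N. A $$ (i, j) * v $ j)"
    using i by (simp add: sum_subtractf)
  finally show ?thesis by (simp add: algebra_simps sum_subtractf sum_distrib_left)
qed

lemma laplacian_symmetric:
  assumes "A \<in> carrier_mat N N" and "\<forall>i<N. \<forall>j<N. A $$ (i, j) = A $$ (j, i)"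
  shows "transpose_mat (laplacian A) = laplacian A"
  using assms laplacian_carrier[OF assms(1)] by (intro eq_matI) (auto simp: laplacian_index)

lemma symmetric_mat_adjoint:
  fixes M :: "real mat"
  assumes "M \<in> carrier_mat n n" "transpose_mat M = M" "u \<in> carrier_vec n" "v \<in> carrier_vec n"
  shows "u \<bullet> (M *\<^sub>v v) = (M *\<^sub>v u) \<bullet> v"
  using transpose_vec_mult_scalar[of M n n v u] assms by simp

lemma laplacian_quadratic_form:
  assumes A: "A \<in> carrier_mat N N" and sym: "\<forall>i<N. \<forall>j<N. A $$ (i, j) = A $$ (j, i)"
    and v: "v \<in> carrier_vec N"
  shows "2 * (v \<bullet> (laplacian A *\<^sub>v v)) = (\<Sum>i<N. \<Sum>j<N. A $$ (i, j) * (v $ i - v $ j)\<^sup>2)"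
proof -
  let ?s = "\<Sum>i<N. \<Sum>j<N. A $$ (i, j) * (v $ i - v $ j) * v $ i"
  have "v \<bullet> (laplacian A *\<^sub>v v) = (\<Sum>i<N. v $ i * (laplacian A *\<^sub>v v) $ i)"
    using laplacian_carrier[OF A] v by (auto simp: scalar_prod_def atLeast0LessThan)
  also have "\<dots> = ?s"
    using A v by (intro sum.cong)
      (auto simp: laplacian_mult_vec_index sum_distrib_left algebra_simps simp del: index_mult_mat_vec)
  finally have s: "v \<bullet> (laplacian A *\<^sub>v v) = ?s" .
  also have "?s = (\<Sum>j<N. \<Sum>i<N. A $$ (i, j) * (v $ i - v $ j) * v $ i)" by (rule sum.swap)
  also have "\<dots> = (\<Sum>i<N. \<Sum>j<N. A $$ (i, j) * (v $ j - v $ i) * v $ j)"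
    using sym by (intro sum.cong) auto
  finally have "2 * (v \<bullet> (laplacian A *\<^sub>v v))
      = ?s + (\<Sum>i<N. \<Sum>j<N. A $$ (i, j) * (v $ j - v $ i) * v $ j)"
    using s by simp
  then show ?thesis
    by (simp add: sum.distrib[symmetric] power2_eq_square algebra_simps)
qed

lemma weighted_adjacency_nonneg:
  "weighted_adjacency N G A \<Longrightarrow> i < N \<Longrightarrow> j < N \<Longrightarrow> 0 \<le> A $$ (i, j)"
  unfolding weighted_adjacency_def by (cases "(i, j) \<in> parcs G") (auto intro: less_imp_le)

lemma laplacian_psd:
  assumes A: "weighted_adjacency N G A" and v: "v \<in> carrier_vec N"
  shows "0 \<le> v \<bullet> (laplacian A *\<^sub>v v)"
proof -
  have "0 \<le> (\<Sum>i<N. \<Sum>j<N. A $$ (i, j) * (v $ i - v $ j)\<^sup>2)"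
    using weighted_adjacency_nonneg[OF A] by (intro sum_nonneg) simp
  then show ?thesis
    using laplacian_quadratic_form[of A N v] A v by (simp add: weighted_adjacency_def)
qed

text \<open>
  A kernel vector annihilates the quadratic form, a sum of nonnegative terms, so its entries agree
  along every edge and hence along every path.
\<close>

lemma laplacian_kernel_constant:
  assumes A: "weighted_adjacency N G A" and graph: "pair_graph G" "pverts G = {..<N}"
    and conn: "Digraph_Component.connected (with_proj G)"
    and v: "v \<in> carrier_vec N" and Lv: "laplacian A *\<^sub>v v = 0\<^sub>v N"
    and ij: "i < N" "j < N"
  shows "v $ i = v $ j"
proof -
  interpret pair_graph G by fact
  have total: "(\<Sum>i<N. \<Sum>j<N. A $$ (i, j) * (v $ i - v $ j)\<^sup>2) = 0"
    using laplacian_quadratic_form[of A N v] A v Lv by (simp add: weighted_adjacency_def)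
  have zero: "A $$ (i, j) * (v $ i - v $ j)\<^sup>2 = 0" if "i < N" "j < N" for i j
  proof -
    have nn: "0 \<le> A $$ (i, j) * (v $ i - v $ j)\<^sup>2" if "i < N" "j < N" for i j
      using that weighted_adjacency_nonneg[OF A] by simp
    have "(\<Sum>j<N. A $$ (i, j) * (v $ i - v $ j)\<^sup>2) = 0"
      using total that(1) nn by (subst (asm) sum_nonneg_eq_0_iff) (auto intro!: sum_nonneg)
    then show ?thesis
      using that nn by (subst (asm) sum_nonneg_eq_0_iff) auto
  qed
  have edge: "v $ i = v $ j" if e: "(i, j) \<in> parcs G" for i j
  proof -
    have "i < N" "j < N" using wellformed[of "(i, j)"] e graph(2) by auto
    moreover from this have "A $$ (i, j) > 0" using e A unfolding weighted_adjacency_def by blast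
    ultimately show ?thesis using zero[of i j] by simp
  qed
  have "i \<rightarrow>\<^sup>*\<^bsub>with_proj (mk_symmetric (with_proj G))\<^esub> j"
    using conn ij graph(2) by (auto simp: connected_def strongly_connected_def)
  then have "(i, j) \<in> (parcs (mk_symmetric (with_proj G)))\<^sup>*"
    unfolding reachable_def by (simp add: rtrancl_on_rtranclI)
  then show ?thesis
  proof (induction rule: rtrancl_induct)
    case (step j k)
    then show ?case using edge by (auto simp: parcs_mk_symmetric)
  qed simp
qed

lemma laplacian_mult_ones:
  assumes "A \<in> carrier_mat N N"
  shows "laplacian A *\<^sub>v ones_vec N = 0\<^sub>v N"
  using laplacian_carrier[OF assms]
  by (intro eq_vecI)
    (auto simp: laplacian_mult_vec_index[OF assms] ones_vec_def simp del: index_mult_mat_vec)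

section \<open>The spectrum of a connected graph\<close>

text \<open>
  The Schur decomposition read as a statement about columns: the span of the first columns of \<open>P\<close>
  is invariant under \<open>L\<close>, and the diagonal lists the eigenvalues in the prescribed order.
\<close>

lemma schur_basis:
  fixes L :: "real mat"
  assumes L: "L \<in> carrier_mat n n" and cp: "char_poly L = (\<Prod>e\<leftarrow>es. [:- e, 1:])"
  obtains B P Q where "B \<in> carrier_mat n n" "P \<in> carrier_mat n n" "Q \<in> carrier_mat n n"
    "P * Q = 1\<^sub>m n" "Q * P = 1\<^sub>m n" "\<forall>j<n. B $$ (j, j) = es ! j"
    "\<forall>i<n. \<forall>j<n. (L *\<^sub>v col P j) $ i = (\<Sum>l\<le>j. B $$ (l, j) * P $$ (i, l))"
proof -
  obtain B P Q where d: "schur_decomposition L es = (B, P, Q)" by (metis prod_cases3)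
  have s: "similar_mat_wit L B P Q" "upper_triangular B" "diag_mat B = es"
    using schur_decomposition[OF L cp d] by auto
  have c: "B \<in> carrier_mat n n" "P \<in> carrier_mat n n" "Q \<in> carrier_mat n n"
    and PQ: "P * Q = 1\<^sub>m n" "Q * P = 1\<^sub>m n" "L = P * B * Q"
    using similar_mat_witD2[OF L s(1)] by blast+
  have "L * P = P * B * (Q * P)"
    unfolding PQ(3) using c by (intro assoc_mult_mat) auto
  then have LP: "L * P = P * B" using c PQ(2) by simp
  have LP': "(L *\<^sub>v col P j) $ i = (\<Sum>l\<le>j. B $$ (l, j) * P $$ (i, l))" if "i < n" "j < n" for i j
  proof -
    have "(L *\<^sub>v col P j) $ i = (P * B) $$ (i, j)"
      using c L that by (simp flip: LP)
    also have "\<dots> = (\<Sum>l<n. P $$ (i, l) * B $$ (l, j))"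
      using c that by (auto simp: scalar_prod_def atLeast0LessThan)
    also have "\<dots> = (\<Sum>l\<le>j. P $$ (i, l) * B $$ (l, j))"
      using that c upper_triangularD[OF s(2)] by (intro sum.mono_neutral_right) auto
    finally show ?thesis by (simp add: mult.commute)
  qed
  have diag: "B $$ (j, j) = es ! j" if "j < n" for j
    using that c s(3) by (auto simp: diag_mat_def)
  show ?thesis
    by (rule that[OF c PQ(1,2)]) (simp_all add: diag LP' del: index_mult_mat_vec)
qed

lemma invertible_columns_independent:
  fixes P Q :: "real mat"
  assumes P: "P \<in> carrier_mat n n" "Q \<in> carrier_mat n n" and QP: "Q * P = 1\<^sub>m n"
    and ij: "i < n" "j < n" "i \<noteq> j"
    and eq: "\<And>k. k < n \<Longrightarrow> a * P $$ (k, i) = b * P $$ (k, j)"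
  shows "a = 0"
proof -
  have e: "(\<Sum>k<n. Q $$ (i, k) * P $$ (k, l)) = (if i = l then 1 else 0)" if "l < n" for l
    using arg_cong[OF QP, of "\<lambda>M. M $$ (i, l)"] P ij that
    by (auto simp: scalar_prod_def atLeast0LessThan)
  have "(\<Sum>k<n. Q $$ (i, k) * (a * P $$ (k, i))) = (\<Sum>k<n. Q $$ (i, k) * (b * P $$ (k, j)))"
    using eq by (intro sum.cong) auto
  then have "a * (\<Sum>k<n. Q $$ (i, k) * P $$ (k, i)) = b * (\<Sum>k<n. Q $$ (i, k) * P $$ (k, j))"
    by (simp add: sum_distrib_left mult.left_commute)
  then show ?thesis using e ij by simp
qed

lemma ordered_eigenvalues_list:
  assumes "ordered_eigenvalues N L lam"
  shows "char_poly L = (\<Prod>e\<leftarrow>map lam [1..<Suc N]. [:- e, 1:])"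
  using assms prod.distinct_set_conv_list[of "[1..<Suc N]" "\<lambda>i. [:- lam i, 1:]"]
  by (simp add: ordered_eigenvalues_def atLeastLessThanSuc_atLeastAtMost comp_def del: upt_Suc)

lemma ordered_eigenvalues_iff_eigenvalue:
  assumes "L \<in> carrier_mat N N" "ordered_eigenvalues N L lam"
  shows "eigenvalue L e \<longleftrightarrow> (\<exists>i\<in>{1..N}. e = lam i)"
  using assms unfolding ordered_eigenvalues_def
  by (auto simp: eigenvalue_root_char_poly poly_prod)

lemma laplacian_eigenvalue_nonneg:
  assumes A: "weighted_adjacency N G A" and e: "eigenvalue (laplacian A) e"
  shows "0 \<le> e"
proof -
  have L: "laplacian A \<in> carrier_mat N N"
    using A laplacian_carrier by (auto simp: weighted_adjacency_def)
  obtain v where v: "v \<in> carrier_vec N" "v \<noteq> 0\<^sub>v N" "laplacian A *\<^sub>v v = e \<cdot>\<^sub>v v"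
    using e L by (auto simp: eigenvalue_def eigenvector_def)
  then have "0 \<le> e * (v \<bullet> v)" using laplacian_psd[OF A v(1)] by simp
  moreover have "0 < v \<bullet> v"
    using v conjugate_square_greater_0_vec[of v N] by simp
  ultimately show ?thesis by (simp add: zero_le_mult_iff)
qed

lemma laplacian_smallest_eigenvalue:
  assumes N: "N > 0" and A: "weighted_adjacency N G A"
    and ev: "ordered_eigenvalues N (laplacian A) lam"
  shows "lam 1 = 0"
proof -
  have L: "laplacian A \<in> carrier_mat N N" and A': "A \<in> carrier_mat N N"
    using A laplacian_carrier by (auto simp: weighted_adjacency_def)
  have "ones_vec N $ 0 \<noteq> 0\<^sub>v N $ 0" using N by (simp add: ones_vec_def)
  then have "ones_vec N \<noteq> 0\<^sub>v N" by metis
  then have "eigenvalue (laplacian A) 0"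
    unfolding eigenvalue_def eigenvector_def using L laplacian_mult_ones[OF A']
    by (intro exI[of _ "ones_vec N"]) (auto simp: ones_vec_def)
  then obtain i where "i \<in> {1..N}" "lam i = 0"
    using ordered_eigenvalues_iff_eigenvalue[OF L ev] by auto
  then have "lam 1 \<le> 0"
    using ev by (auto simp: ordered_eigenvalues_def dest: mono_onD[of _ _ 1 i])
  moreover have "eigenvalue (laplacian A) (lam 1)"
    using ordered_eigenvalues_iff_eigenvalue[OF L ev] N by force
  ultimately show ?thesis using laplacian_eigenvalue_nonneg[OF A] by fastforce
qed

text \<open>
  The hypothesis counts \<open>lam 2\<close> by algebraic multiplicity, so a second zero yields only a generalised
  kernel vector \<open>p\<close> with \<open>L (L p) = 0\<close>. Symmetry turns it into a kernel vector, because
  \<open>\<parallel>L p\<parallel>\<^sup>2 = p \<bullet> L (L p)\<close>. Then two columns of an invertible matrix are both constant vectors.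
\<close>

lemma laplacian_second_eigenvalue_pos:
  assumes N: "N \<ge> 2" and A: "weighted_adjacency N G A"
    and graph: "pair_graph G" "pverts G = {..<N}"
    and conn: "Digraph_Component.connected (with_proj G)"
    and ev: "ordered_eigenvalues N (laplacian A) lam"
  shows "0 < lam 2"
proof (rule ccontr)
  assume neg: "\<not> 0 < lam 2"
  define L where "L = laplacian A"
  have A': "A \<in> carrier_mat N N" "\<forall>i<N. \<forall>j<N. A $$ (i, j) = A $$ (j, i)"
    using A by (auto simp: weighted_adjacency_def)
  have L: "L \<in> carrier_mat N N" and sym: "transpose_mat L = L"
    unfolding L_def using laplacian_carrier laplacian_symmetric A' by auto
  have lam1: "lam 1 = 0" using laplacian_smallest_eigenvalue[OF _ A ev] N by simp
  have "lam 1 \<le> lam 2"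
    using ev N by (auto simp: ordered_eigenvalues_def dest: mono_onD[of _ _ 1 2])
  then have lam2: "lam 2 = 0" using lam1 neg by simp
  obtain B P Q where c: "B \<in> carrier_mat N N" "P \<in> carrier_mat N N" "Q \<in> carrier_mat N N"
    and "P * Q = 1\<^sub>m N" and QP: "Q * P = 1\<^sub>m N" and diag': "\<forall>j<N. B $$ (j, j) = map lam [1..<Suc N] ! j"
    and LP': "\<forall>i<N. \<forall>j<N.
      (L *\<^sub>v col P j) $ i = (\<Sum>l\<le>j. B $$ (l, j) * P $$ (i, l))"
    using schur_basis[OF L ordered_eigenvalues_list[OF ev[folded L_def]]] .
  note diag = diag'[rule_format] and LP = LP'[rule_format]
  have col: "col P j \<in> carrier_vec N" for j by (rule carrier_vecI) (use c(2) in simp)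
  have B0: "B $$ (0, 0) = 0" "B $$ (1, 1) = 0"
    using diag[of 0] diag[of 1] N lam1 lam2
    by (auto simp del: upt_Suc simp: numeral_2_eq_2)
  have p0: "L *\<^sub>v col P 0 = 0\<^sub>v N"
    using LP[of _ 0] L c N B0 by (intro eq_vecI) auto
  have p1: "L *\<^sub>v col P 1 = B $$ (0, 1) \<cdot>\<^sub>v col P 0"
    using LP[of _ 1] L c N B0 by (intro eq_vecI) auto
  have "(L *\<^sub>v col P 1) \<bullet> (L *\<^sub>v col P 1) = col P 1 \<bullet> (L *\<^sub>v (L *\<^sub>v col P 1))"
    using symmetric_mat_adjoint[OF L sym col[of 1]] L col by simp
  also have "L *\<^sub>v (L *\<^sub>v col P 1) = 0\<^sub>v N"
    unfolding p1 using p0 mult_mat_vec[OF L col] by (auto intro: eq_vecI)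
  finally have "(L *\<^sub>v col P 1) \<bullet> (L *\<^sub>v col P 1) = 0" using col by simp
  then have Lp1: "L *\<^sub>v col P 1 = 0\<^sub>v N"
    using conjugate_square_eq_0_vec[of "L *\<^sub>v col P 1" N] mult_mat_vec_carrier[OF L col]
    by simp
  have const: "P $$ (k, j) = P $$ (0, j)" if "L *\<^sub>v col P j = 0\<^sub>v N" "k < N" "j < N" for k j
    using laplacian_kernel_constant[OF A graph conn col that(1)[unfolded L_def] that(2), of 0] that c N by simp
  have "P $$ (0, 1) * P $$ (k, 0) = P $$ (0, 0) * P $$ (k, 1)" if "k < N" for k
    using const[OF p0 that] const[OF Lp1 that] N by simp
  then have "P $$ (0, 1) = 0"
    using N by (intro invertible_columns_independent[OF c(2,3) QP, of 0 1 _ "P $$ (0, 0)"]) auto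
  then have "1 * P $$ (k, 1) = 0 * P $$ (k, 0)" if "k < N" for k
    using const[OF Lp1 that] N by simp
  then have "(1 :: real) = 0"
    using N by (intro invertible_columns_independent[OF c(2,3) QP, of 1 0 1 0]) auto
  then show False by simp
qed

section \<open>Convergence of the iteration\<close>

text \<open>
  Symmetry moves \<open>L\<close> onto the column \<open>p\<^sub>j\<close> in \<open>p\<^sub>j \<bullet> L y\<close>, which makes the recursion for
  \<open>p\<^sub>j \<bullet> \<xi> k\<close> depend on the modes \<open>l \<le> j\<close> only; strong induction on \<open>j\<close> treats those below \<open>j\<close> as
  convergent forcing. The zero eigenvalue has the characteristic root \<open>1\<close> and is marginal:
  placed first, its mode is unforced, and equal initial values keep it constant.
\<close>

lemma momentum_iterates_convergent:
  fixes L :: "real mat" and \<xi> :: "nat \<Rightarrow> real vec"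
  assumes L: "L \<in> carrier_mat n n" and sym: "transpose_mat L = L"
    and cp: "char_poly L = (\<Prod>e\<leftarrow>es. [:- e, 1:])"
    and es: "es ! 0 = 0"
    and stable: "\<And>j. 0 < j \<Longrightarrow> j < n \<Longrightarrow> \<bar>\<beta> - \<alpha> * es ! j * \<gamma>\<bar> < 1"
      "\<And>j. 0 < j \<Longrightarrow> j < n \<Longrightarrow>
        \<bar>1 + \<beta> - \<alpha> * es ! j * (1 + \<gamma>)\<bar> < 1 + (\<beta> - \<alpha> * es ! j * \<gamma>)"
    and \<xi>: "\<And>k. \<xi> k \<in> carrier_vec n" "\<xi> 1 = \<xi> 0"
    and step: "\<And>k. \<xi> (Suc (Suc k)) = (1 + \<beta>) \<cdot>\<^sub>v \<xi> (Suc k) - \<beta> \<cdot>\<^sub>v \<xi> k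
      - \<alpha> \<cdot>\<^sub>v (L *\<^sub>v ((1 + \<gamma>) \<cdot>\<^sub>v \<xi> (Suc k) - \<gamma> \<cdot>\<^sub>v \<xi> k))"
    and i: "i < n"
  shows "convergent (\<lambda>k. \<xi> k $ i)"
proof -
  obtain B P Q where c: "B \<in> carrier_mat n n" "P \<in> carrier_mat n n" "Q \<in> carrier_mat n n"
    and PQ: "P * Q = 1\<^sub>m n" and "Q * P = 1\<^sub>m n" and diag': "\<forall>j<n. B $$ (j, j) = es ! j"
    and LP': "\<forall>i<n. \<forall>j<n.
      (L *\<^sub>v col P j) $ i = (\<Sum>l\<le>j. B $$ (l, j) * P $$ (i, l))"
    using schur_basis[OF L cp] .
  note diag = diag'[rule_format] and LP = LP'[rule_format]
  have col: "col P j \<in> carrier_vec n" for j by (rule carrier_vecI) (use c(2) in simp)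
  define z where "z j k = col P j \<bullet> \<xi> k" for j k
  have LPv: "col P j \<bullet> (L *\<^sub>v v) = (\<Sum>l\<le>j. B $$ (l, j) * (col P l \<bullet> v))"
    if "j < n" "v \<in> carrier_vec n" for j v
  proof -
    have "col P j \<bullet> (L *\<^sub>v v) = (L *\<^sub>v col P j) \<bullet> v"
      using symmetric_mat_adjoint[OF L sym col that(2)] .
    also have "\<dots> = (\<Sum>i<n. (\<Sum>l\<le>j. B $$ (l, j) * P $$ (i, l)) * v $ i)"
      using that LP by (auto simp: scalar_prod_def atLeast0LessThan intro!: sum.cong simp del: index_mult_mat_vec)
    also have "\<dots> = (\<Sum>l\<le>j. \<Sum>i<n. B $$ (l, j) * P $$ (i, l) * v $ i)"
      unfolding sum_distrib_right by (rule sum.swap)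
    also have "\<dots> = (\<Sum>l\<le>j. B $$ (l, j) * (col P l \<bullet> v))"
      using that c by (intro sum.cong)
        (auto simp: scalar_prod_def atLeast0LessThan sum_distrib_left mult.assoc intro!: sum.cong)
    finally show ?thesis .
  qed
  have zstep: "z j (Suc (Suc k)) = (1 + \<beta>) * z j (Suc k) - \<beta> * z j k
      - \<alpha> * (\<Sum>l\<le>j. B $$ (l, j) * ((1 + \<gamma>) * z l (Suc k) - \<gamma> * z l k))" if "j < n" for j k
  proof -
    let ?y = "(1 + \<gamma>) \<cdot>\<^sub>v \<xi> (Suc k) - \<gamma> \<cdot>\<^sub>v \<xi> k"
    have y: "?y \<in> carrier_vec n" using \<xi> by simp
    have dist: "col P l \<bullet> (a \<cdot>\<^sub>v u - b \<cdot>\<^sub>v w) = a * (col P l \<bullet> u) - b * (col P l \<bullet> w)"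
      if "u \<in> carrier_vec n" "w \<in> carrier_vec n" for l a b u w
      using that col[of l] by (simp add: scalar_prod_minus_distrib[of _ n])
    have "z j (Suc (Suc k)) = (1 + \<beta>) * z j (Suc k) - \<beta> * z j k - \<alpha> * (col P j \<bullet> (L *\<^sub>v ?y))"
      unfolding z_def step[of k] using \<xi>(1) L y col[of j]
      by (subst scalar_prod_minus_distrib[of _ n]) (auto simp: dist)
    also have "col P j \<bullet> (L *\<^sub>v ?y) = (\<Sum>l\<le>j. B $$ (l, j) * ((1 + \<gamma>) * z l (Suc k) - \<gamma> * z l k))"
      unfolding LPv[OF that y] by (simp add: dist \<xi> z_def)
    finally show ?thesis .
  qed
  have conv: "convergent (z j)" if "j < n" for j
    using that
  proof (induction j rule: less_induct)
    case (less j)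
    show ?case
    proof (cases "j = 0")
      case True
      have "z 0 (Suc k) = z 0 k" for k
      proof (induction k)
        case 0
        show ?case using \<xi>(2) by (simp add: z_def)
      next
        case (Suc k)
        then show ?case
          using zstep[of 0 k] diag[of 0] less.prems True es by (simp add: algebra_simps)
      qed
      then have "z 0 k = z 0 0" for k by (induction k) auto
      then have "z 0 = (\<lambda>_. z 0 0)" by (rule ext)
      then show ?thesis using True convergent_const by metis
    next
      case False
      define f where "f k = - \<alpha> * (\<Sum>l<j. B $$ (l, j) * ((1 + \<gamma>) * z l (Suc k) - \<gamma> * z l k))" for k
      have "convergent (\<lambda>k. z l k)" if "l < j" for l using less that by simp
      then have "convergent f"
        unfolding f_def
        by (intro convergent_mult convergent_const convergent_sum convergent_diff)
          (auto simp: convergent_Suc_iff)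
      moreover have "z j (Suc (Suc k)) = (1 + \<beta> - \<alpha> * es ! j * (1 + \<gamma>)) * z j (Suc k)
          - (\<beta> - \<alpha> * es ! j * \<gamma>) * z j k + f k" for k
        unfolding zstep[OF less.prems] f_def lessThan_Suc_atMost[symmetric]
        using diag[OF less.prems] by (simp add: algebra_simps)
      ultimately show ?thesis
        using second_order_recursion_convergent[OF stable] less.prems False by blast
    qed
  qed
  \<comment> \<open>Since \<open>P * Q\<close> is the identity, so is \<open>Q\<^sup>T * P\<^sup>T\<close>: the iterate is recovered from its modes.\<close>
  have "\<xi> k $ i = (\<Sum>j<n. Q $$ (j, i) * z j k)" for k
  proof -
    have "(\<Sum>j<n. Q $$ (j, i) * z j k) = (\<Sum>j<n. \<Sum>m<n. P $$ (m, j) * Q $$ (j, i) * \<xi> k $ m)"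
      using c \<xi>(1)[of k] by (intro sum.cong)
        (auto simp: z_def scalar_prod_def atLeast0LessThan sum_distrib_left intro!: sum.cong)
    also have "\<dots> = (\<Sum>m<n. (\<Sum>j<n. P $$ (m, j) * Q $$ (j, i)) * \<xi> k $ m)"
      unfolding sum_distrib_right by (rule sum.swap)
    also have "\<dots> = (\<Sum>m<n. (if m = i then \<xi> k $ m else 0))"
    proof (rule sum.cong)
      fix m assume "m \<in> {..<n}"
      then have "(\<Sum>j<n. P $$ (m, j) * Q $$ (j, i)) = (if m = i then 1 else 0)"
        using arg_cong[OF PQ, of "\<lambda>M. M $$ (m, i)"] c i
        by (auto simp: scalar_prod_def atLeast0LessThan)
      then show "(\<Sum>j<n. P $$ (m, j) * Q $$ (j, i)) * \<xi> k $ m = (if m = i then \<xi> k $ m else 0)"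
        by simp
    qed simp
    also have "\<dots> = \<xi> k $ i" using i by simp
    finally show ?thesis by simp
  qed
  then show ?thesis
    using conv by (simp only:) (intro convergent_sum convergent_mult convergent_const, auto)
qed


text \<open>
  A limit of the iterates must be a fixed point, hence a constant vector. The sum of the entries
  follows the unforced recursion \<open>S (k + 2) = (1 + \<beta>) S (k + 1) - \<beta> S k\<close> from equal initial values,
  so it never changes, and this selects the mean.
\<close>

lemma laplacian_momentum_limit:
  assumes A: "weighted_adjacency N G A" and graph: "pair_graph G" "pverts G = {..<N}"
    and conn: "Digraph_Component.connected (with_proj G)"
    and \<alpha>: "\<alpha> \<noteq> 0"
    and \<xi>: "\<And>k. \<xi> k \<in> carrier_vec N" "\<xi> 1 = \<xi> 0"
    and step: "\<And>k. \<xi> (Suc (Suc k)) = (1 + \<beta>) \<cdot>\<^sub>v \<xi> (Suc k) - \<beta> \<cdot>\<^sub>v \<xi> k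
      - \<alpha> \<cdot>\<^sub>v (laplacian A *\<^sub>v ((1 + \<gamma>) \<cdot>\<^sub>v \<xi> (Suc k) - \<gamma> \<cdot>\<^sub>v \<xi> k))"
    and conv: "\<And>i. i < N \<Longrightarrow> convergent (\<lambda>k. \<xi> k $ i)"
    and i: "i < N"
  shows "(\<lambda>k. \<xi> k $ i) \<longlonglongrightarrow> (1 / real N) * (\<Sum>j<N. \<xi> 0 $ j)"
proof -
  have A': "A \<in> carrier_mat N N" "\<forall>i<N. \<forall>j<N. A $$ (i, j) = A $$ (j, i)"
    using A by (auto simp: weighted_adjacency_def)
  note L = laplacian_carrier[OF A'(1)]
  define y where "y k = (1 + \<gamma>) \<cdot>\<^sub>v \<xi> (Suc k) - \<gamma> \<cdot>\<^sub>v \<xi> k" for k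
  have y: "y k \<in> carrier_vec N" for k using \<xi>(1) by (simp add: y_def)
  have entry: "\<xi> (Suc (Suc k)) $ i = (1 + \<beta>) * \<xi> (Suc k) $ i - \<beta> * \<xi> k $ i
      - \<alpha> * (laplacian A *\<^sub>v y k) $ i" if "i < N" for k i
    using step[of k] \<xi>(1)[of k] \<xi>(1)[of "Suc k"] L that
    by (simp add: y_def[symmetric] del: index_mult_mat_vec)
  define v where "v = vec N (\<lambda>i. lim (\<lambda>k. \<xi> k $ i))"
  have v: "v \<in> carrier_vec N" by (simp add: v_def)
  have lim: "(\<lambda>k. \<xi> k $ i) \<longlonglongrightarrow> v $ i" if "i < N" for i
    using conv[OF that] that by (simp add: v_def convergent_LIMSEQ_iff)
  have limS: "(\<lambda>k. \<xi> (Suc k) $ i) \<longlonglongrightarrow> v $ i" if "i < N" for i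
    using lim[OF that] by (rule LIMSEQ_Suc)
  have limy: "(\<lambda>k. y k $ i) \<longlonglongrightarrow> v $ i" if "i < N" for i
  proof -
    have "(\<lambda>k. (1 + \<gamma>) * \<xi> (Suc k) $ i - \<gamma> * \<xi> k $ i) \<longlonglongrightarrow> (1 + \<gamma>) * v $ i - \<gamma> * v $ i"
      by (intro tendsto_intros lim limS that)
    moreover have "(\<lambda>k. (1 + \<gamma>) * \<xi> (Suc k) $ i - \<gamma> * \<xi> k $ i) = (\<lambda>k. y k $ i)"
      using \<xi>(1) that by (auto simp: y_def carrier_vecD[OF \<xi>(1)])
    moreover have "(1 + \<gamma>) * v $ i - \<gamma> * v $ i = v $ i" by (simp add: algebra_simps)
    ultimately show ?thesis by simp
  qed
  have "(laplacian A *\<^sub>v v) $ i = 0" if "i < N" for i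
  proof -
    have "(\<lambda>k. (laplacian A *\<^sub>v y k) $ i) \<longlonglongrightarrow> (laplacian A *\<^sub>v v) $ i"
      unfolding laplacian_mult_vec_index[OF A'(1) y that] laplacian_mult_vec_index[OF A'(1) v that]
      using that by (intro tendsto_intros limy) auto
    then have "(\<lambda>k. \<xi> (Suc (Suc k)) $ i) \<longlonglongrightarrow>
        (1 + \<beta>) * v $ i - \<beta> * v $ i - \<alpha> * (laplacian A *\<^sub>v v) $ i"
      unfolding entry[OF that] by (intro tendsto_intros lim limS that)
    moreover have "(\<lambda>k. \<xi> (Suc (Suc k)) $ i) \<longlonglongrightarrow> v $ i"
      using limS[OF that] by (rule LIMSEQ_Suc)
    ultimately have "(1 + \<beta>) * v $ i - \<beta> * v $ i - \<alpha> * (laplacian A *\<^sub>v v) $ i = v $ i"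
      by (rule LIMSEQ_unique)
    then have "\<alpha> * (laplacian A *\<^sub>v v) $ i = 0" by (simp add: algebra_simps del: index_mult_mat_vec)
    then show ?thesis using \<alpha> by (simp del: index_mult_mat_vec)
  qed
  then have "laplacian A *\<^sub>v v = 0\<^sub>v N"
    using L by (intro eq_vecI) (auto simp del: index_mult_mat_vec)
  then have const: "v $ j = v $ i" if "j < N" for j
    using laplacian_kernel_constant[OF A graph conn v _ that i] by simp
  define S where "S k = (\<Sum>j<N. \<xi> k $ j)" for k
  have Ly: "(\<Sum>j<N. (laplacian A *\<^sub>v y k) $ j) = 0" for k
  proof -
    have "(\<Sum>j<N. (laplacian A *\<^sub>v y k) $ j) = ones_vec N \<bullet> (laplacian A *\<^sub>v y k)"
      using L by (auto simp: scalar_prod_def ones_vec_def atLeast0LessThan simp del: index_mult_mat_vec intro!: sum.cong)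
    also have "\<dots> = (laplacian A *\<^sub>v ones_vec N) \<bullet> y k"
      using y by (intro symmetric_mat_adjoint[OF L laplacian_symmetric[OF A']]) (auto simp: ones_vec_def)
    finally show ?thesis using y[of k] by (simp add: laplacian_mult_ones[OF A'(1)])
  qed
  have "S (Suc k) = S k" for k
  proof (induction k)
    case 0
    show ?case using \<xi>(2) by (simp add: S_def)
  next
    case (Suc k)
    have "S (Suc (Suc k)) = (1 + \<beta>) * S (Suc k) - \<beta> * S k"
      using Ly[of k] entry
      by (simp add: S_def sum_subtractf sum.distrib flip: sum_distrib_left del: index_mult_mat_vec)
    then show ?case using Suc by (simp add: algebra_simps)
  qed
  then have "S k = S 0" for k by (induction k) auto
  then have "S = (\<lambda>_. S 0)" by (rule ext)
  moreover have "S \<longlonglongrightarrow> (\<Sum>j<N. v $ j)"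
    unfolding S_def by (intro tendsto_sum lim) simp
  ultimately have "(\<Sum>j<N. v $ j) = S 0"
    by (metis LIMSEQ_unique tendsto_const)
  then have "real N * v $ i = S 0" using const by simp
  then have "v $ i = (1 / real N) * (\<Sum>j<N. \<xi> 0 $ j)"
    using i by (simp add: S_def field_simps)
  then show ?thesis using lim[OF i] by simp
qed

theorem mainTheorem2:
  fixes N :: nat
    and G :: "nat pair_pre_digraph"
    and A L :: "real mat"
    and lam :: "nat \<Rightarrow> real"
    and r :: "real vec"
    and \<xi> y x :: "nat \<Rightarrow> real vec"
    and \<alpha> \<beta> \<gamma> \<delta> \<rho> :: real
  assumes N: "N \<ge> 2"
    and graph: "pair_graph G" "pverts G = {..<N}"
    and connected: "Digraph_Component.connected (with_proj G)"
    and adjacency: "weighted_adjacency N G A"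
    and L: "L = laplacian A"
    and eigenvalues: "ordered_eigenvalues N L lam"
    and r: "r \<in> carrier_vec N"
    and \<rho>: "\<rho> = 1 - sqrt (lam 2 / lam N)"
    and \<alpha>: "\<alpha> = (1 + \<rho>) / lam N"
    and \<beta>: "\<beta> = \<rho>\<^sup>2 / (2 - \<rho>)"
    and \<gamma>: "\<gamma> = \<rho>\<^sup>2 / ((1 + \<rho>) * (2 - \<rho>))"
    and \<delta>: "\<delta> = \<rho>\<^sup>2 / (1 - \<rho>\<^sup>2)"
    and init: "\<xi> 0 = r" "\<xi> 1 = r"
    and \<xi>: "\<And>k. k \<ge> 1 \<Longrightarrow>
      \<xi> (k + 1) = (1 + \<beta>) \<cdot>\<^sub>v \<xi> k - \<beta> \<cdot>\<^sub>v \<xi> (k - 1) - \<alpha> \<cdot>\<^sub>v (L *\<^sub>v y k)"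
    and y: "\<And>k. k \<ge> 1 \<Longrightarrow> y k = (1 + \<gamma>) \<cdot>\<^sub>v \<xi> k - \<gamma> \<cdot>\<^sub>v \<xi> (k - 1)"
    and x: "\<And>k. k \<ge> 1 \<Longrightarrow> x k = (1 + \<delta>) \<cdot>\<^sub>v \<xi> k - \<delta> \<cdot>\<^sub>v \<xi> (k - 1)"
  shows "\<forall>i<N. (\<lambda>k. x k $ i) \<longlonglongrightarrow> (1 / real N) * (\<Sum>j<N. r $ j)"
proof -
  have A: "A \<in> carrier_mat N N" "\<forall>i<N. \<forall>j<N. A $$ (i, j) = A $$ (j, i)"
    using adjacency by (auto simp: weighted_adjacency_def)
  have Lc: "L \<in> carrier_mat N N" and sym: "transpose_mat L = L"
    unfolding L using laplacian_carrier laplacian_symmetric A by auto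
  have lam1: "lam 1 = 0"
    using laplacian_smallest_eigenvalue[OF _ adjacency eigenvalues[unfolded L]] N by simp
  have lam2: "0 < lam 2"
    using laplacian_second_eigenvalue_pos[OF N adjacency graph connected eigenvalues[unfolded L]] .
  have mono: "mono_on {1..N} lam" using eigenvalues by (simp add: ordered_eigenvalues_def)
  have bounds: "0 < lam i \<and> lam i \<le> lam N" if "2 \<le> i" "i \<le> N" for i
    using mono_onD[OF mono, of 2 i] mono_onD[OF mono, of i N] lam2 that by auto
  have \<rho>': "0 \<le> \<rho>" "\<rho> < 1" using bounds[of 2] bounds[of N] N by (auto simp: \<rho>)
  have \<alpha>0: "\<alpha> \<noteq> 0" using bounds[of N] N \<rho>' by (simp add: \<alpha>)
  have step: "\<xi> (Suc (Suc k)) = (1 + \<beta>) \<cdot>\<^sub>v \<xi> (Suc k) - \<beta> \<cdot>\<^sub>v \<xi> k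
      - \<alpha> \<cdot>\<^sub>v (L *\<^sub>v ((1 + \<gamma>) \<cdot>\<^sub>v \<xi> (Suc k) - \<gamma> \<cdot>\<^sub>v \<xi> k))" for k
    using \<xi>[of "Suc k"] y[of "Suc k"] by simp
  have carrier: "\<xi> k \<in> carrier_vec N" for k
  proof (induction k rule: less_induct)
    case (less k)
    consider "k = 0" | "k = 1" | m where "k = Suc (Suc m)" by (metis One_nat_def not0_implies_Suc)
    then show ?case
    proof cases
      case 3
      have "L *\<^sub>v w \<in> carrier_vec N" for w by (rule carrier_vecI) (use Lc in simp)
      then show ?thesis unfolding 3 step using less[of m] less[of "Suc m"] 3 by simp
    qed (use init r in auto)
  qed
  let ?es = "map lam [1..<Suc N]"
  have es: "?es ! j = lam (Suc j)" if "j < N" for j using that by (simp del: upt_Suc)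
  have conv: "convergent (\<lambda>k. \<xi> k $ i)" if "i < N" for i
  proof (rule momentum_iterates_convergent[OF Lc sym ordered_eigenvalues_list[OF eigenvalues]])
    show "?es ! 0 = 0" using es[of 0] lam1 N by simp
    show "\<bar>\<beta> - \<alpha> * ?es ! j * \<gamma>\<bar> < 1"
      "\<bar>1 + \<beta> - \<alpha> * ?es ! j * (1 + \<gamma>)\<bar> < 1 + (\<beta> - \<alpha> * ?es ! j * \<gamma>)" if "0 < j" "j < N" for j
      using triple_momentum_mode_stable[OF _ _ \<rho>' \<alpha> \<beta> \<gamma>] bounds[of "Suc j"] es[of j] that by simp_all
  qed (use carrier init step that in auto)
  have lim: "(\<lambda>k. \<xi> k $ i) \<longlonglongrightarrow> (1 / real N) * (\<Sum>j<N. r $ j)" if "i < N" for i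
    using laplacian_momentum_limit[OF adjacency graph connected \<alpha>0 carrier _ step[unfolded L] conv that]
      init by simp
  show ?thesis
  proof (intro allI impI)
    fix i assume i: "i < N"
    let ?m = "(1 / real N) * (\<Sum>j<N. r $ j)"
    have "(\<lambda>k. (1 + \<delta>) * \<xi> (Suc k) $ i - \<delta> * \<xi> k $ i) \<longlonglongrightarrow> (1 + \<delta>) * ?m - \<delta> * ?m"
      by (intro tendsto_intros lim i LIMSEQ_Suc)
    moreover have "(\<lambda>k. (1 + \<delta>) * \<xi> (Suc k) $ i - \<delta> * \<xi> k $ i) = (\<lambda>k. x (Suc k) $ i)"
      using x i by (auto simp: carrier_vecD[OF carrier])
    moreover have "(1 + \<delta>) * m - \<delta> * m = m" for m by (simp add: algebra_simps)
    ultimately have "(\<lambda>k. x (Suc k) $ i) \<longlonglongrightarrow> ?m" by (simp only:)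
    then show "(\<lambda>k. x k $ i) \<longlonglongrightarrow> ?m" by (rule LIMSEQ_imp_Suc)
  qed
qed

end
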